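(* Consider the convex optimization problem $\min_{x\in\mathbb{R}^n}F(x):=f(x)+g(x)$ under the standing assumptions listed in the context (with $L$ the Lipschitz constant of $\nabla f$), where $f$ satisfies the structured assumption listed in the context and $g$ is the group LASSO regularizer, i.e., $g(x)=\sum_{J\in\mathcal{J}}\omega_J\|x_J\|_2$, where $\omega_J\ge0$ and $\mathcal{J}$ is a partition of $\{1,\dots,n\}$. Assume that the step-size $\gamma>0$ satisfies $\gamma<\frac1L$. Let the sequence $\{x^k\}$ be generated by the proximal gradient (PG) method with step-size $\gamma$. Then the sequence $\{x^k\}$ converges to an optimal solution $\bar x$ linearly.
   Context: Structured assumption: $f(x)=h(Ax)+\langle q,x\rangle$, where $A$ is some given $m\times n$ matrix, $q$ is some given vector in $\mathbb{R}^n$, and $h:\mathbb{R}^m\to(-\infty,\infty]$ is closed, proper and convex, with the properties that $h$ is continuously differentiable on $\mathrm{dom}\,h$, assumed to be open, and $h$ is strongly convex on any compact convex subset of $\mathrm{dom}\,h$. Standing assumptions: with $\mathrm{dom}\,\phi:=\{x:\phi(x)<\infty\}$, $f$ is proper, lower semicontinuous and smooth on $\mathrm{dom} f$, which is assumed to be open, and $\nabla f$ is Lipschitz continuous with constant $L>0$ on a closed set $C\supseteq\mathrm{dom} f\cap\mathrm{dom} g$; $F(x)\ge F_{\min}$ for all $x\in\mathbb{R}^n$. (The paper's further standing assumptions, that $g$ is proper, lower semicontinuous, continuous in its domain and prox-bounded, hold automatically for the group LASSO regularizer.) PG method with step-size $\gamma$: $x^{k+1}=\mathrm{Prox}_g^\gamma(x^k-\gamma\nabla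 f(x^k))$ for $k=0,1,2,\dots$, where $\mathrm{Prox}_g^\gamma(a):=\arg\min_{x\in\mathbb{R}^n}\{g(x)+\frac1{2\gamma}\|x-a\|^2\}$. "Converges to $\bar x$ linearly" is understood as: there exist $k_0>0$, $0<\sigma<1$, $\rho_0>0$, $0<\rho<1$ such that for all $k\ge k_0$, $F(x^{k+1})-F(\bar x)\le\sigma(F(x^k)-F(\bar x))$ and $\|x^k-\bar x\|\le\rho_0\rho^k$.
   Formalization: The formal statement additionally assumes that an optimal solution exists (F_min is attained); without this the claim fails, e.g. for f(x)=log(1+e^x), g=0, which is bounded below but has no minimizer. *)

theory Defs
  imports "HOL-Analysis.Analysis"
begin

definition edom :: "('a \<Rightarrow> ereal) \<Rightarrow> 'a set"
  where "edom f = {x. f x < \<infinity>}"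

definition proper :: "('a \<Rightarrow> ereal) \<Rightarrow> bool"
  where "proper f \<longleftrightarrow> edom f \<noteq> {} \<and> (\<forall>x. f x \<noteq> -\<infinity>)"

definition epigraph :: "('a \<Rightarrow> ereal) \<Rightarrow> ('a \<times> real) set"
  where "epigraph f = {(x, r). f x \<le> ereal r}"

definition closed_fun :: "('a::topological_space \<Rightarrow> ereal) \<Rightarrow> bool"
  where "closed_fun f \<longleftrightarrow> closed (epigraph f)"

definition convex_fun :: "('a::real_vector \<Rightarrow> ereal) \<Rightarrow> bool"
  where "convex_fun f \<longleftrightarrow> convex (epigraph f)"

definition lsc :: "('a::topological_space \<Rightarrow> ereal) \<Rightarrow> bool"
  where "lsc f \<longleftrightarrow> (\<forall>x. f x \<le> Liminf (nhds x) f)"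

text \<open>Gradients are only considered at interior points of the effective domain; without this
  restriction the convention \<^term>\<open>real_of_ereal \<infinity> = 0\<close> would produce spurious zero gradients
  where the function is \<open>\<infinity>\<close>.\<close>

definition has_egrad :: "('a::real_inner \<Rightarrow> ereal) \<Rightarrow> 'a \<Rightarrow> 'a \<Rightarrow> bool"
  where "has_egrad f x d \<longleftrightarrow> x \<in> interior (edom f) \<and> GDERIV (\<lambda>y. real_of_ereal (f y)) x :> d"

definition egrad :: "('a::real_inner \<Rightarrow> ereal) \<Rightarrow> 'a \<Rightarrow> 'a"
  where "egrad f x = (THE d. has_egrad f x d)"

definition ediff_on :: "'a::real_inner set \<Rightarrow> ('a \<Rightarrow> ereal) \<Rightarrow> bool"
  where "ediff_on S f \<longleftrightarrow> (\<forall>x\<in>S. \<exists>d. has_egrad f x d)"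

definition C1_fun_on :: "'a::real_inner set \<Rightarrow> ('a \<Rightarrow> ereal) \<Rightarrow> bool"
  where "C1_fun_on S f \<longleftrightarrow> ediff_on S f \<and> continuous_on S (egrad f)"

definition strongly_convex_on :: "'a::real_normed_vector set \<Rightarrow> ('a \<Rightarrow> ereal) \<Rightarrow> bool"
  where "strongly_convex_on K f \<longleftrightarrow>
    (\<exists>\<mu>>0. \<forall>x\<in>K. \<forall>y\<in>K. \<forall>t\<in>{0..1}.
       f ((1 - t) *\<^sub>R x + t *\<^sub>R y)
         \<le> ereal (1 - t) * f x + ereal t * f y - ereal (\<mu> / 2 * t * (1 - t) * (norm (x - y))\<^sup>2))"

definition group_lasso :: "'n set set \<Rightarrow> ('n set \<Rightarrow> real) \<Rightarrow> real ^ 'n \<Rightarrow> ereal"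
  where "group_lasso \<J> \<omega> x = ereal (\<Sum>J\<in>\<J>. \<omega> J * L2_set (\<lambda>i. x $ i) J)"

definition argmin :: "('a \<Rightarrow> ereal) \<Rightarrow> 'a set"
  where "argmin \<phi> = {x. is_arg_min \<phi> (\<lambda>_. True) x}"

definition prox :: "('a::real_normed_vector \<Rightarrow> ereal) \<Rightarrow> real \<Rightarrow> 'a \<Rightarrow> 'a set"
  where "prox g \<gamma> a = argmin (\<lambda>x. g x + ereal (1 / (2 * \<gamma>) * (norm (x - a))\<^sup>2))"

definition pg_sequence ::
    "('a::real_inner \<Rightarrow> ereal) \<Rightarrow> ('a \<Rightarrow> ereal) \<Rightarrow> real \<Rightarrow> (nat \<Rightarrow> 'a) \<Rightarrow> bool"
  where "pg_sequence f g \<gamma> x \<longleftrightarrow> (\<forall>k. x (Suc k) \<in> prox g \<gamma> (x k - \<gamma> *\<^sub>R egrad f (x k)))"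

definition converges_linearly ::
    "('a::real_normed_vector \<Rightarrow> ereal) \<Rightarrow> (nat \<Rightarrow> 'a) \<Rightarrow> 'a \<Rightarrow> bool"
  where "converges_linearly F x xbar \<longleftrightarrow>
    (\<exists>k0>0. \<exists>\<sigma> \<rho>0 \<rho> :: real. 0 < \<sigma> \<and> \<sigma> < 1 \<and> 0 < \<rho>0 \<and> 0 < \<rho> \<and> \<rho> < 1 \<and>
       (\<forall>k\<ge>k0. F (x (Suc k)) - F xbar \<le> ereal \<sigma> * (F (x k) - F xbar)
             \<and> norm (x k - xbar) \<le> \<rho>0 * \<rho> ^ k))"

end

theory Submission
  imports Defs
begin

text \<open>
  The domain of \<open>f\<close> equals \<open>C\<close>, hence is clopen, so \<open>f\<close> is finite everywhere with globally
  Lipschitz gradient.  The argument rests on quadratic growth of \<open>F\<close> over bounded sets.  For an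
  optimal \<open>x\<^sup>*\<close> and \<open>v = - \<nabla>f (x\<^sup>*)\<close>, the gap \<open>F x - F x\<^sup>*\<close> is the sum of the Bregman gap of
  \<open>f\<close>, which dominates \<open>|A x - A x\<^sup>*|\<^sup>2\<close> by strong convexity of \<open>h\<close>, and of \<open>g x - \<langle>v, x\<rangle>\<close>,
  which blockwise dominates (on bounded sets) the squared distance to the cone
  \<open>{z. g z = \<langle>v, z\<rangle>}\<close>.  This cone is polyhedral, so a Hoffman bound
  controls the distance to its intersection with \<open>A z = A x\<^sup>*\<close>, all of whose points are optimal.

  A proximal gradient step satisfies
  \<open>F x\<^sup>+ \<le> F z + (|z - x|\<^sup>2 - |z - x\<^sup>+|\<^sup>2) / (2\<gamma>)\<close> for all \<open>z\<close>.  Taking \<open>z\<close> optimal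
  bounds the iterates, \<open>z = x\<close> bounds the step lengths by the gap, and \<open>z\<close> on the segment from \<open>x\<close> to the optimal point
  given by quadratic growth contracts the gap by a fixed factor.
\<close>

section \<open>One-sided directional derivatives and the descent lemma\<close>

lemma GDERIV_along_line:
  fixes f :: "'a::real_inner \<Rightarrow> real"
  assumes "GDERIV f (x + t *\<^sub>R d) :> G"
  shows "((\<lambda>s. f (x + s *\<^sub>R d)) has_real_derivative G \<bullet> d) (at t)"
proof -
  have 1: "(f has_derivative (\<lambda>h. h \<bullet> G)) (at (x + t *\<^sub>R d))"
    using assms by (simp add: gderiv_def)
  have 2: "((\<lambda>s. x + s *\<^sub>R d) has_derivative (\<lambda>s. s *\<^sub>R d)) (at t)"
    by (auto intro!: derivative_eq_intros)
  have "((\<lambda>s. f (x + s *\<^sub>R d)) has_derivative (\<lambda>s. (s *\<^sub>R d) \<bullet> G)) (at t)"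
    using has_derivative_compose[OF 2 1] by simp
  then show ?thesis
    by (simp add: has_field_derivative_def inner_commute mult_commute_abs)
qed

text \<open>Subtract \<open>f x\<close>, divide by \<open>t\<close> and let \<open>t\<close>
  decrease to 0: the quotient tends to the slope, while the quadratic remainder contributes only
  \<open>t * M\<close>, which vanishes. This turns estimates along a segment into first-order
  conditions.\<close>

lemma GDERIV_direction_le:
  fixes f :: "'a::real_inner \<Rightarrow> real"
  assumes "GDERIV f x :> G"
    and le: "\<And>t. 0 < t \<Longrightarrow> t \<le> 1 \<Longrightarrow> f (x + t *\<^sub>R d) \<le> f x + t * c + t\<^sup>2 * M"
  shows "G \<bullet> d \<le> c"
proof -
  have "((\<lambda>s. f (x + s *\<^sub>R d)) has_real_derivative G \<bullet> d) (at 0)"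
    using GDERIV_along_line[of f x 0 d G] assms(1) by simp
  then have "((\<lambda>t. (f (x + t *\<^sub>R d) - f x) / t) \<longlongrightarrow> G \<bullet> d) (at 0)"
    by (simp add: has_field_derivative_iff)
  then have 1: "((\<lambda>t. (f (x + t *\<^sub>R d) - f x) / t) \<longlongrightarrow> G \<bullet> d) (at_right 0)"
    by (rule filterlim_mono) (auto simp: at_le)
  have "((\<lambda>t. c + t * M) \<longlongrightarrow> c + 0 * M) (at_right 0)"
    by (intro tendsto_intros)
  then have 2: "((\<lambda>t. c + t * M) \<longlongrightarrow> c) (at_right 0)"
    by simp
  have "eventually (\<lambda>t. (f (x + t *\<^sub>R d) - f x) / t \<le> c + t * M) (at_right 0)"
  proof (rule eventually_at_rightI[of 0 1])
    fix t :: real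
    assume t: "t \<in> {0<..<1}"
    then have "f (x + t *\<^sub>R d) - f x \<le> t * (c + t * M)"
      using le[of t] by (simp add: algebra_simps power2_eq_square)
    then show "(f (x + t *\<^sub>R d) - f x) / t \<le> c + t * M"
      using t by (simp add: divide_le_eq mult.commute)
  qed simp
  with tendsto_le[OF _ 2 1] show ?thesis
    by simp
qed

lemma GDERIV_minus_direction_le:
  fixes f :: "'a::real_inner \<Rightarrow> real"
  assumes "GDERIV f x :> G"
    and "\<And>t. 0 < t \<Longrightarrow> t \<le> 1 \<Longrightarrow> f x \<le> f (x + t *\<^sub>R d) + t * c"
  shows "- (G \<bullet> d) \<le> c"
  using GDERIV_direction_le[of "\<lambda>y. - f y" x "- G" d c 0] assms GDERIV_minus[OF assms(1)]
  by (auto simp: algebra_simps)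

text \<open>Along the segment, \<open>\<psi>\<close> is \<open>f\<close> minus the linear and
  quadratic terms of the model. Cauchy-Schwarz and the Lipschitz bound make its derivative
  nonpositive on [0, 1], so comparing the endpoints suffices.\<close>

lemma descent_lemma:
  fixes f :: "'a::real_inner \<Rightarrow> real"
  assumes deriv: "\<And>x. GDERIV f x :> G x" and lip: "L-lipschitz_on UNIV G"
  shows "f y \<le> f x + G x \<bullet> (y - x) + L / 2 * (norm (y - x))\<^sup>2"
proof -
  define d where "d = y - x"
  define \<psi> where "\<psi> t = f (x + t *\<^sub>R d) - t * (G x \<bullet> d) - L / 2 * t\<^sup>2 * (norm d)\<^sup>2" for t
  have "\<psi> 1 \<le> \<psi> 0"
  proof (rule DERIV_nonpos_imp_nonincreasing[of 0 1])
    fix t :: real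
    assume t: "0 \<le> t" "t \<le> 1"
    let ?D = "G (x + t *\<^sub>R d) \<bullet> d - G x \<bullet> d - L * t * (norm d)\<^sup>2"
    have "(\<psi> has_real_derivative ?D) (at t)"
      unfolding \<psi>_def
      by (auto intro!: derivative_eq_intros GDERIV_along_line deriv)
    moreover have "?D \<le> 0"
    proof -
      have "(G (x + t *\<^sub>R d) - G x) \<bullet> d \<le> norm (G (x + t *\<^sub>R d) - G x) * norm d"
        by (rule norm_cauchy_schwarz)
      also have "\<dots> \<le> (L * norm (t *\<^sub>R d)) * norm d"
        using lipschitz_onD[OF lip, of "x + t *\<^sub>R d" x]
        by (intro mult_right_mono) (auto simp: dist_norm)
      finally show ?thesis
        using t by (simp add: inner_diff_left power2_eq_square mult.assoc)
    qed
    ultimately show "\<exists>z. (\<psi> has_real_derivative z) (at t) \<and> z \<le> 0"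
      by blast
  qed simp
  then show ?thesis
    by (simp add: \<psi>_def d_def)
qed

section \<open>The basic inequality for one proximal gradient step\<close>

text \<open>Minimality of \<open>p\<close> along the segment towards \<open>z\<close> yields a
  variational inequality; the exact expansion of the squared distance to \<open>a\<close> around
  \<open>p\<close> then supplies the additional term in \<open>z - p\<close>.\<close>

lemma prox_inequality:
  fixes g :: "'a::real_inner \<Rightarrow> real"
  assumes g: "convex_on UNIV g" and \<gamma>: "0 < \<gamma>"
    and min: "\<And>y. g p + 1 / (2 * \<gamma>) * (norm (p - a))\<^sup>2 \<le> g y + 1 / (2 * \<gamma>) * (norm (y - a))\<^sup>2"
  shows "g p + 1 / (2 * \<gamma>) * (norm (p - a))\<^sup>2 + 1 / (2 * \<gamma>) * (norm (z - p))\<^sup>2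
           \<le> g z + 1 / (2 * \<gamma>) * (norm (z - a))\<^sup>2"
proof -
  let ?Q = "\<lambda>y. 1 / (2 * \<gamma>) * (norm (y - a))\<^sup>2"
  have "GDERIV ?Q p :> (1 / \<gamma>) *\<^sub>R (p - a)"
    unfolding gderiv_def power2_norm_eq_inner
    using \<gamma> by (auto intro!: derivative_eq_intros simp: inner_commute)
  \<comment> \<open>Only the quadratic is differentiated; \<open>g\<close> may be nonsmooth and
    enters through its convexity bound on the segment.\<close>
  then have "- ((1 / \<gamma>) *\<^sub>R (p - a) \<bullet> (z - p)) \<le> g z - g p"
  proof (rule GDERIV_minus_direction_le)
    fix t :: real
    assume t: "0 < t" "t \<le> 1"
    have "g (p + t *\<^sub>R (z - p)) \<le> (1 - t) * g p + t * g z"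
      using convex_onD[OF g, of t p z] t by (simp add: algebra_simps)
    with min[of "p + t *\<^sub>R (z - p)"]
    show "?Q p \<le> ?Q (p + t *\<^sub>R (z - p)) + t * (g z - g p)"
      by (simp add: algebra_simps)
  qed
  then have "g p \<le> g z + 1 / \<gamma> * ((p - a) \<bullet> (z - p))"
    by (simp only: inner_scaleR_left)
  moreover have "(norm (z - a))\<^sup>2 = (norm (p - a))\<^sup>2 + 2 * ((p - a) \<bullet> (z - p)) + (norm (z - p))\<^sup>2"
    by (simp add: power2_norm_eq_inner algebra_simps inner_commute)
  then have "1 / (2 * \<gamma>) * (norm (z - a))\<^sup>2 = 1 / (2 * \<gamma>) * (norm (p - a))\<^sup>2
      + 1 / \<gamma> * ((p - a) \<bullet> (z - p)) + 1 / (2 * \<gamma>) * (norm (z - p))\<^sup>2"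
    by (simp add: distrib_left)
  ultimately show ?thesis
    by linarith
qed

text \<open>Completing the square shows that the prox step minimizes \<open>g\<close> plus the
  linearization of \<open>f\<close> at \<open>x\<close> plus a proximity term. The linearization is
  bounded below at \<open>p\<close> by the descent lemma, as \<open>L\<close> is at most
  \<open>1 / \<gamma>\<close>, and above at \<open>z\<close> by convexity.\<close>

lemma proximal_gradient_inequality:
  fixes f g :: "'a::real_inner \<Rightarrow> real"
  assumes deriv: "\<And>x. GDERIV f x :> G x" and lip: "L-lipschitz_on UNIV G"
    and f_convex: "\<And>x y. f x + G x \<bullet> (y - x) \<le> f y"
    and g: "convex_on UNIV g" and \<gamma>: "0 < \<gamma>" "L * \<gamma> \<le> 1"
    and min: "\<And>y. g p + 1 / (2 * \<gamma>) * (norm (p - (x - \<gamma> *\<^sub>R G x)))\<^sup>2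
                  \<le> g y + 1 / (2 * \<gamma>) * (norm (y - (x - \<gamma> *\<^sub>R G x)))\<^sup>2"
  shows "f p + g p \<le> f z + g z + 1 / (2 * \<gamma>) * ((norm (z - x))\<^sup>2 - (norm (z - p))\<^sup>2)"
proof -
  \<comment> \<open>The last summand does not depend on \<open>y\<close>, so it cancels between the
    two sides of the prox inequality.\<close>
  have expand: "1 / (2 * \<gamma>) * (norm (y - (x - \<gamma> *\<^sub>R G x)))\<^sup>2
      = 1 / (2 * \<gamma>) * (norm (y - x))\<^sup>2 + G x \<bullet> (y - x) + \<gamma> / 2 * (norm (G x))\<^sup>2" for y
  proof -
    have "y - (x - \<gamma> *\<^sub>R G x) = (y - x) + \<gamma> *\<^sub>R G x"
      by simp
    then have "(norm (y - (x - \<gamma> *\<^sub>R G x)))\<^sup>2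
        = (norm (y - x))\<^sup>2 + 2 * \<gamma> * (G x \<bullet> (y - x)) + \<gamma>\<^sup>2 * (norm (G x))\<^sup>2"
      by (simp only: power2_norm_eq_inner)
        (simp add: inner_add_left inner_add_right inner_commute power2_eq_square)
    then show ?thesis
      using \<gamma>(1) by (simp add: field_simps power2_eq_square)
  qed
  have "L / 2 * (norm (p - x))\<^sup>2 \<le> 1 / (2 * \<gamma>) * (norm (p - x))\<^sup>2"
    using \<gamma> by (intro mult_right_mono) (auto simp: field_simps)
  then have "f p \<le> f x + G x \<bullet> (p - x) + 1 / (2 * \<gamma>) * (norm (p - x))\<^sup>2"
    using descent_lemma[OF deriv lip, of p x] by linarith
  with prox_inequality[OF g \<gamma>(1) min, of z] f_convex[of x z] show ?thesis
    unfolding expand by (simp add: right_diff_distrib)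
qed

section \<open>Sequences with geometrically decaying increments\<close>

text \<open>A geometric series dominates the telescoping series of increments, which therefore
  converges; its tail from \<open>k\<close> on sums to \<open>l - x k\<close> and is bounded by the
  geometric tail.\<close>

lemma geometric_increments_converge:
  fixes x :: "nat \<Rightarrow> 'a::banach"
  assumes step: "\<And>k. norm (x (Suc k) - x k) \<le> M * \<rho> ^ k" and \<rho>: "0 \<le> \<rho>" "\<rho> < 1"
  obtains l where "x \<longlonglongrightarrow> l" "\<And>k. norm (x k - l) \<le> M / (1 - \<rho>) * \<rho> ^ k"
proof -
  have M: "0 \<le> M"
    using order_trans[OF norm_ge_zero step[of 0]] by simp
  have tail: "(\<lambda>j. M * \<rho> ^ k * \<rho> ^ j) sums (M * \<rho> ^ k * (1 / (1 - \<rho>)))" for k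
    using \<rho> by (intro sums_mult geometric_sums) auto
  have le: "norm (x (Suc (j + k)) - x (j + k)) \<le> M * \<rho> ^ k * \<rho> ^ j" for j k
    using step[of "j + k"] by (simp add: power_add mult.commute mult.left_commute)
  have summ: "summable (\<lambda>j. x (Suc (j + k)) - x (j + k))" for k
    by (rule summable_comparison_test'[OF sums_summable[OF tail[of k]], of 0]) (use le in auto)
  obtain l where l: "x \<longlonglongrightarrow> l"
  proof -
    have "(\<lambda>n. \<Sum>j<n. x (Suc j) - x j) \<longlonglongrightarrow> (\<Sum>j. x (Suc j) - x j)"
      using summable_LIMSEQ[OF summ[of 0]] by simp
    then have "(\<lambda>n. x n - x 0) \<longlonglongrightarrow> (\<Sum>j. x (Suc j) - x j)"
      by (simp add: sum_lessThan_telescope)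
    then have "(\<lambda>n. x n - x 0 + x 0) \<longlonglongrightarrow> (\<Sum>j. x (Suc j) - x j) + x 0"
      by (intro tendsto_intros)
    then show ?thesis
      using that by simp
  qed
  have "norm (x k - l) \<le> M / (1 - \<rho>) * \<rho> ^ k" for k
  proof -
    have "(\<lambda>j. x (j + k)) \<longlonglongrightarrow> l"
      using l by (rule LIMSEQ_ignore_initial_segment)
    then have "(\<lambda>j. x (Suc j + k) - x (j + k)) sums (l - x (0 + k))"
      by (rule telescope_sums)
    then have s: "(\<lambda>j. x (Suc (j + k)) - x (j + k)) sums (l - x k)"
      by simp
    have "norm (l - x k) \<le> M * \<rho> ^ k * (1 / (1 - \<rho>))"
      by (rule norm_sums_le[OF s tail le])
    then show ?thesis
      by (simp add: norm_minus_commute)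
  qed
  with l show ?thesis
    by (rule that)
qed

section \<open>Error bounds for linear systems over polyhedral cones\<close>

text \<open>By homogeneity only unit vectors of \<open>K\<close> matter. They form a compact set on
  which \<open>norm (A u)\<close> attains a positive minimum, whose reciprocal is the constant; if
  there are none, \<open>K\<close> contains no nonzero vector.\<close>

lemma closed_cone_lower_bound:
  fixes A :: "'a::euclidean_space \<Rightarrow> 'b::real_normed_vector"
  assumes A: "bounded_linear A" and K: "closed K" "cone K"
    and ker: "\<And>u. u \<in> K \<Longrightarrow> A u = 0 \<Longrightarrow> u = 0"
  shows "\<exists>\<kappa>\<ge>0. \<forall>u\<in>K. norm u \<le> \<kappa> * norm (A u)"
proof (cases "K \<inter> sphere 0 1 = {}")
  case True
  have "u = 0" if "u \<in> K" for u
  proof (rule ccontr)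
    assume "u \<noteq> 0"
    then have "(1 / norm u) *\<^sub>R u \<in> K \<inter> sphere 0 1"
      using K(2) that by (auto intro: mem_cone)
    with True show False
      by blast
  qed
  then show ?thesis
    by (intro exI[of _ 0]) auto
next
  case False
  have "compact (K \<inter> sphere 0 1)"
    using K(1) by (simp add: closed_Int_compact)
  moreover have "continuous_on (K \<inter> sphere 0 1) (\<lambda>u. norm (A u))"
    by (intro continuous_intros linear_continuous_on A)
  ultimately obtain w where w: "w \<in> K \<inter> sphere 0 1"
    and le: "\<And>u. u \<in> K \<inter> sphere 0 1 \<Longrightarrow> norm (A w) \<le> norm (A u)"
    using continuous_attains_inf[OF _ False] by blast
  have pos: "0 < norm (A w)"
    using ker[of w] w by auto
  have "norm u \<le> 1 / norm (A w) * norm (A u)" if u: "u \<in> K" for u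
  proof (cases "u = 0")
    case False
    then have "norm (A w) \<le> norm (A ((1 / norm u) *\<^sub>R u))"
      using K(2) u by (intro le) (auto intro: mem_cone)
    also have "\<dots> = norm (A u) / norm u"
      by (simp add: linear_simps(5)[OF A] bounded_linear.linear linear_scale)
    finally show ?thesis
      using pos False by (simp add: field_simps)
  qed simp
  with pos show ?thesis
    by (intro exI[of _ "1 / norm (A w)"]) auto
qed

text \<open>A Hoffman bound.  If \<open>p'\<close> is the feasible point nearest to \<open>p\<close>, then no nonzero kernel
  vector of \<open>A\<close> in \<open>V\<close> has a sign pattern compatible with \<open>p' - p\<close>, since moving \<open>p'\<close> against it
  would stay feasible and come closer.  The finitely many sign patterns then make the constant
  uniform.\<close>

lemma hoffman_bound:
  fixes A :: "real ^ 'n \<Rightarrow> 'b::real_normed_vector" and c s :: "real ^ 'n"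
  assumes A: "bounded_linear A" and V: "subspace V"
    and s: "s \<in> V" "\<And>i. 0 \<le> c $ i * s $ i"
  shows "\<exists>\<kappa>\<ge>0. \<forall>p\<in>V. (\<forall>i. 0 \<le> c $ i * p $ i) \<longrightarrow>
    (\<exists>p'\<in>V. (\<forall>i. 0 \<le> c $ i * p' $ i) \<and> A p' = A s \<and> norm (p - p') \<le> \<kappa> * norm (A p - A s))"
proof -
  \<comment> \<open>A sign pattern is a pair of index sets, so there are finitely many. The patterns
    that are \<open>ok\<close> are those whose cone meets the kernel of \<open>A\<close> trivially,
    where the preceding lemma provides a constant.\<close>
  define K where "K = (\<lambda>(P, N). V \<inter> {u :: real ^ 'n.
      \<forall>i. (i \<in> P \<longrightarrow> 0 \<le> u $ i) \<and> (i \<in> N \<longrightarrow> u $ i \<le> 0) \<and> (i \<notin> P \<union> N \<longrightarrow> u $ i = 0)})"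
  define ok where "ok \<pi> \<longleftrightarrow> (\<forall>u\<in>K \<pi>. A u = 0 \<longrightarrow> u = 0)" for \<pi>
  have "\<exists>\<kappa>\<ge>0. ok \<pi> \<longrightarrow> (\<forall>u\<in>K \<pi>. norm u \<le> \<kappa> * norm (A u))" for \<pi>
  proof (cases "ok \<pi>")
    case True
    obtain P N where \<pi>: "\<pi> = (P, N)"
      by fastforce
    have "closed (K \<pi>)"
      unfolding K_def \<pi> prod.case
      by (intro closed_Int closed_subspace V closed_Collect_all closed_Collect_conj
          closed_Collect_imp closed_Collect_le closed_Collect_eq open_Collect_const continuous_intros)
    moreover have "cone (K \<pi>)"
      using V by (auto simp: cone_def K_def \<pi> subspace_scale mult_nonneg_nonpos)
    ultimately show ?thesis
      using closed_cone_lower_bound[OF A, of "K \<pi>"] True by (auto simp: ok_def)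
  qed auto
  then obtain k where k: "\<And>\<pi>. 0 \<le> k \<pi>"
    "\<And>\<pi> u. ok \<pi> \<Longrightarrow> u \<in> K \<pi> \<Longrightarrow> norm u \<le> k \<pi> * norm (A u)"
    by metis
  define \<kappa> where "\<kappa> = (\<Sum>\<pi>\<in>UNIV. k \<pi>)"
  have k_le: "k \<pi> \<le> \<kappa>" for \<pi>
    unfolding \<kappa>_def by (rule member_le_sum) (auto simp: k)
  interpret A: bounded_linear A
    by (rule A)
  have "\<exists>p'\<in>V. (\<forall>i. 0 \<le> c $ i * p' $ i) \<and> A p' = A s \<and> norm (p - p') \<le> \<kappa> * norm (A p - A s)"
    if p: "p \<in> V" "\<And>i. 0 \<le> c $ i * p $ i" for p
  proof -
    define S where "S = V \<inter> {z. \<forall>i. 0 \<le> c $ i * z $ i} \<inter> {z. A z = A s}"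
    have "closed S"
      unfolding S_def
      by (intro closed_Int closed_subspace V closed_Collect_all closed_Collect_le
          closed_Collect_eq continuous_intros linear_continuous_on A)
    moreover have "S \<noteq> {}"
      using s by (auto simp: S_def)
    ultimately obtain p' where p': "p' \<in> S" and nearest: "\<And>z. z \<in> S \<Longrightarrow> dist p p' \<le> dist p z"
      using distance_attains_inf[of S p] by blast
    define d where "d = p' - p"
    \<comment> \<open>The pattern of \<open>d\<close> itself: \<open>d\<close> then lies in its
      cone, and the uniform bound applies to \<open>d\<close> once the pattern is shown to be
      \<open>ok\<close>.\<close>
    define \<pi> where "\<pi> = ({i. 0 < d $ i}, {i. d $ i < 0})"
    have d_V: "d \<in> V"
      using p p' V by (simp add: d_def S_def subspace_diff)
    then have d_K: "d \<in> K \<pi>"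
      by (auto simp: K_def \<pi>_def)
    have "ok \<pi>"
      unfolding ok_def
    proof (intro ballI impI, rule ccontr)
      fix u
      assume u: "u \<in> K \<pi>" "A u = 0" "u \<noteq> 0"
      have conf: "(0 < d $ i \<longrightarrow> 0 \<le> u $ i) \<and> (d $ i < 0 \<longrightarrow> u $ i \<le> 0) \<and> (d $ i = 0 \<longrightarrow> u $ i = 0)" for i
        using u(1) by (auto simp: K_def \<pi>_def)
      have "\<forall>\<^sub>F \<epsilon> in at_right 0. \<epsilon> * \<bar>u $ i\<bar> \<le> \<bar>d $ i\<bar>" for i
      proof (cases "d $ i = 0")
        case False
        have "((\<lambda>\<epsilon>. \<epsilon> * \<bar>u $ i\<bar>) \<longlongrightarrow> 0 * \<bar>u $ i\<bar>) (at_right 0)"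
          by (intro tendsto_intros)
        then have "\<forall>\<^sub>F \<epsilon> in at_right 0. \<epsilon> * \<bar>u $ i\<bar> < \<bar>d $ i\<bar>"
          by (rule order_tendstoD) (use False in auto)
        then show ?thesis
          by (rule eventually_mono) auto
      qed (use conf[of i] in auto)
      \<comment> \<open>One positive \<epsilon> serves all coordinates, because there are finitely
        many of them and \<open>u\<close> vanishes wherever \<open>d\<close> does.\<close>
      then have "\<forall>\<^sub>F \<epsilon> in at_right 0. (\<forall>i. \<epsilon> * \<bar>u $ i\<bar> \<le> \<bar>d $ i\<bar>) \<and> (0::real) < \<epsilon>"
        by (intro eventually_conj eventually_all_finite eventually_at_right_less) auto
      then have "\<exists>\<epsilon>::real. (\<forall>i. \<epsilon> * \<bar>u $ i\<bar> \<le> \<bar>d $ i\<bar>) \<and> 0 < \<epsilon>"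
        by (rule eventually_happens'[rotated]) simp
      then obtain \<epsilon> :: real where \<epsilon>: "0 < \<epsilon>" "\<And>i. \<epsilon> * \<bar>u $ i\<bar> \<le> \<bar>d $ i\<bar>"
        by blast
      define z where "z = p' - \<epsilon> *\<^sub>R u"
      \<comment> \<open>Subtracting \<open>\<epsilon> *\<^sub>R u\<close> shrinks each coordinate of
        \<open>d\<close> towards 0 without changing its sign. Hence \<open>z\<close> lies
        coordinatewise between \<open>p\<close> and \<open>p'\<close>, which preserves the sign
        constraints, and it is strictly closer to \<open>p\<close> since some coordinate of
        \<open>u\<close> is nonzero.\<close>
      have between: "\<exists>\<theta>. 0 \<le> \<theta> \<and> \<theta> \<le> 1 \<and> (u $ i \<noteq> 0 \<longrightarrow> \<theta> < 1) \<and> d $ i - \<epsilon> * u $ i = \<theta> * d $ i" for i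
      proof (cases "d $ i = 0")
        case False
        define r where "r = \<epsilon> * \<bar>u $ i\<bar> / \<bar>d $ i\<bar>"
        have "0 \<le> r" "r \<le> 1"
          using \<epsilon>(1) \<epsilon>(2)[of i] False by (simp_all add: r_def)
        moreover have "u $ i \<noteq> 0 \<longrightarrow> r \<noteq> 0"
          using \<epsilon>(1) False by (simp add: r_def)
        moreover have "d $ i - \<epsilon> * u $ i = (1 - r) * d $ i"
          using conf[of i] False
          by (cases "0 < d $ i") (auto simp: r_def left_diff_distrib abs_of_nonneg abs_of_nonpos)
        ultimately show ?thesis
          by (intro exI[of _ "1 - r"]) auto
      qed (use conf[of i] in auto)
      have "0 \<le> c $ i * z $ i" for i
      proof -
        obtain \<theta> where \<theta>: "0 \<le> \<theta>" "\<theta> \<le> 1" "d $ i - \<epsilon> * u $ i = \<theta> * d $ i"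
          using between[of i] by blast
        then have "z $ i = (1 - \<theta>) * p $ i + \<theta> * p' $ i"
          by (simp add: z_def d_def algebra_simps)
        then have "c $ i * z $ i = (1 - \<theta>) * (c $ i * p $ i) + \<theta> * (c $ i * p' $ i)"
          by (simp only: distrib_left mult.left_commute)
        moreover have "0 \<le> c $ i * p' $ i"
          using p' by (simp add: S_def)
        ultimately show ?thesis
          using p(2)[of i] \<theta> by simp
      qed
      moreover have "z \<in> V"
        using p' u(1) V by (auto simp: z_def S_def K_def \<pi>_def intro!: subspace_diff subspace_scale)
      moreover have "A z = A s"
        using p' u(2) by (simp add: z_def S_def A.diff A.scaleR)
      ultimately have "z \<in> S"
        by (simp add: S_def)
      then have "norm d \<le> norm (d - \<epsilon> *\<^sub>R u)"
        using nearest[of z] by (simp add: dist_norm d_def z_def norm_minus_commute algebra_simps)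
      moreover have "norm (d - \<epsilon> *\<^sub>R u) < norm d"
      proof -
        obtain j where j: "u $ j \<noteq> 0"
          using u(3) by (auto simp: vec_eq_iff)
        have le: "((d - \<epsilon> *\<^sub>R u) $ i)\<^sup>2 \<le> (d $ i)\<^sup>2" for i
        proof -
          obtain \<theta> where \<theta>: "0 \<le> \<theta>" "\<theta> \<le> 1" "d $ i - \<epsilon> * u $ i = \<theta> * d $ i"
            using between[of i] by blast
          then have "\<bar>d $ i - \<epsilon> * u $ i\<bar> \<le> \<bar>d $ i\<bar>"
            by (simp add: abs_mult mult_left_le_one_le)
          then show ?thesis
            by (simp add: abs_le_square_iff)
        qed
        have less: "((d - \<epsilon> *\<^sub>R u) $ j)\<^sup>2 < (d $ j)\<^sup>2"
        proof -
          obtain \<theta> where \<theta>: "0 \<le> \<theta>" "\<theta> < 1" "d $ j - \<epsilon> * u $ j = \<theta> * d $ j"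
            using between[of j] j by blast
          moreover have "d $ j \<noteq> 0"
            using conf[of j] j by auto
          ultimately have "\<bar>d $ j - \<epsilon> * u $ j\<bar> < \<bar>d $ j\<bar>"
            by (simp add: abs_mult)
          then have "\<bar>d $ j - \<epsilon> * u $ j\<bar>\<^sup>2 < \<bar>d $ j\<bar>\<^sup>2"
            by (intro power_strict_mono) auto
          then show ?thesis
            by simp
        qed
        have "(\<Sum>i\<in>UNIV. ((d - \<epsilon> *\<^sub>R u) $ i)\<^sup>2) < (\<Sum>i\<in>UNIV. (d $ i)\<^sup>2)"
          using le less by (intro sum_strict_mono_ex1) auto
        then show ?thesis
          by (simp add: norm_vec_def L2_set_def)
      qed
      ultimately show False
        by simp
    qed
    then have "norm d \<le> k \<pi> * norm (A d)"
      using d_K by (rule k(2))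
    also have "\<dots> \<le> \<kappa> * norm (A d)"
      by (intro mult_right_mono k_le) simp
    finally have "norm (p - p') \<le> \<kappa> * norm (A p - A s)"
      using p' by (simp add: d_def S_def A.diff norm_minus_commute)
    with p' show ?thesis
      by (auto simp: S_def)
  qed
  moreover have "0 \<le> \<kappa>"
    by (simp add: \<kappa>_def sum_nonneg k)
  ultimately show ?thesis
    by blast
qed

section \<open>The group norm, its subgradients and the faces they expose\<close>

text \<open>Real-valued counterpart of \<open>group_lasso\<close>, which lets the convex analysis
  run in the reals instead of \<open>ereal\<close>.\<close>

definition group_norm :: "'n set set \<Rightarrow> ('n set \<Rightarrow> real) \<Rightarrow> real ^ 'n \<Rightarrow> real"
  where "group_norm \<J> \<omega> x = (\<Sum>J\<in>\<J>. \<omega> J * L2_set (\<lambda>i. x $ i) J)"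

lemma group_norm_0 [simp]: "group_norm \<J> \<omega> 0 = 0"
  by (simp add: group_norm_def L2_set_def)

lemma group_norm_scaleR: "0 \<le> r \<Longrightarrow> group_norm \<J> \<omega> (r *\<^sub>R x) = r * group_norm \<J> \<omega> x"
  by (simp add: group_norm_def L2_set_right_distrib[symmetric] sum_distrib_left mult.left_commute)

lemma group_norm_triangle:
  assumes "\<And>J. J \<in> \<J> \<Longrightarrow> 0 \<le> \<omega> J"
  shows "group_norm \<J> \<omega> (x + y) \<le> group_norm \<J> \<omega> x + group_norm \<J> \<omega> y"
proof -
  have "L2_set (\<lambda>i. (x + y) $ i) J \<le> L2_set (\<lambda>i. x $ i) J + L2_set (\<lambda>i. y $ i) J" for J
    using L2_set_triangle_ineq[of "\<lambda>i. x $ i" "\<lambda>i. y $ i" J]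
    by (simp only: vector_add_component)
  then show ?thesis
    unfolding group_norm_def sum.distrib[symmetric] distrib_left[symmetric]
    by (intro sum_mono mult_left_mono assms)
qed

lemma convex_on_group_norm:
  fixes \<J> :: "'n::finite set set"
  assumes "\<And>J. J \<in> \<J> \<Longrightarrow> 0 \<le> \<omega> J"
  shows "convex_on UNIV (group_norm \<J> \<omega>)"
proof (intro convex_onI)
  fix t :: real and x y :: "real ^ 'n"
  assume "0 < t" "t < 1"
  then show "group_norm \<J> \<omega> ((1 - t) *\<^sub>R x + t *\<^sub>R y)
      \<le> (1 - t) * group_norm \<J> \<omega> x + t * group_norm \<J> \<omega> y"
    using group_norm_triangle[of \<J> \<omega> "(1 - t) *\<^sub>R x" "t *\<^sub>R y"] assms
    by (simp add: group_norm_scaleR)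
qed simp

lemma continuous_on_group_norm: "continuous_on S (group_norm \<J> \<omega>)"
  unfolding group_norm_def L2_set_def by (intro continuous_intros)

lemma sum_UNIV_partition:
  fixes u :: "'n::finite \<Rightarrow> 'b::comm_monoid_add"
  assumes "partition_on UNIV \<J>"
  shows "(\<Sum>i\<in>UNIV. u i) = (\<Sum>J\<in>\<J>. \<Sum>i\<in>J. u i)"
  using sum.Union_disjoint[of \<J> u] partition_onD1[OF assms] partition_onD2[OF assms]
  by (auto simp: disjoint_def)

text \<open>Testing the subgradient inequality at 0 and at twice \<open>xs\<close> forces the
  equality by homogeneity. Testing it at the restriction of \<open>v\<close> to a block gives
  \<open>?n\<^sup>2 \<le> \<omega> J * ?n\<close>, hence the dual norm bound.\<close>

lemma subgradient_group_norm:
  fixes v xs :: "real ^ 'n"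
  assumes part: "partition_on UNIV \<J>" and \<omega>: "\<And>J. J \<in> \<J> \<Longrightarrow> 0 \<le> \<omega> J"
    and sub: "\<And>z. group_norm \<J> \<omega> xs + v \<bullet> (z - xs) \<le> group_norm \<J> \<omega> z"
  shows "group_norm \<J> \<omega> xs = v \<bullet> xs"
    and "J \<in> \<J> \<Longrightarrow> L2_set (\<lambda>i. v $ i) J \<le> \<omega> J"
proof -
  show eq: "group_norm \<J> \<omega> xs = v \<bullet> xs"
    using sub[of 0] sub[of "2 *\<^sub>R xs"] by (simp add: group_norm_scaleR inner_diff_right)
  assume J: "J \<in> \<J>"
  define z :: "real ^ 'n" where "z = (\<chi> i. if i \<in> J then v $ i else 0)"
  let ?n = "L2_set (\<lambda>i. v $ i) J"
  have "v \<bullet> z = (\<Sum>i\<in>UNIV. if i \<in> J then (v $ i)\<^sup>2 else 0)"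
    by (auto simp: inner_vec_def z_def power2_eq_square intro!: sum.cong)
  also have "\<dots> = ?n\<^sup>2"
    by (simp add: sum.If_cases L2_set_def sum_nonneg)
  finally have vz: "v \<bullet> z = ?n\<^sup>2" .
  have block: "L2_set (\<lambda>i. z $ i) J' = (if J' = J then ?n else 0)" if "J' \<in> \<J>" for J'
  proof (cases "J' = J")
    case True
    then show ?thesis
      by (auto simp: z_def intro!: L2_set_cong)
  next
    case False
    then have "J' \<inter> J = {}"
      using partition_onD2[OF part] J that by (auto simp: disjoint_def)
    then have "L2_set (\<lambda>i. z $ i) J' = L2_set (\<lambda>i. 0) J'"
      by (intro L2_set_cong) (auto simp: z_def)
    with False show ?thesis
      by (simp add: L2_set_def)
  qed
  have "group_norm \<J> \<omega> z = (\<Sum>J'\<in>\<J>. if J' = J then \<omega> J * ?n else 0)"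
    unfolding group_norm_def by (intro sum.cong) (auto simp: block)
  also have "\<dots> = \<omega> J * ?n"
    using J by (simp add: sum.delta)
  finally have "?n\<^sup>2 \<le> \<omega> J * ?n"
    using sub[of z] eq vz by (simp add: inner_diff_right)
  then show "?n \<le> \<omega> J"
    using \<omega>[OF J] L2_set_nonneg[of "\<lambda>i. v $ i" J]
    by (cases "?n = 0") (auto simp: power2_eq_square)
qed

text \<open>The subtracted vector is a point of the block's cone close to \<open>x\<close>. If
  \<open>v\<close> is shorter than \<omega>, the gap is at least
  \<open>(\<omega> - L2_set v J) * L2_set x J\<close>, which dominates the squared length of bounded
  \<open>x\<close>. If \<open>v\<close> has length \<omega> > 0, it is rescaled by \<open>r\<close>
  to the length of \<open>x\<close>, and the squared distance is exactly \<open>2 * r\<close> times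
  the gap. Using \<open>\<bar>R\<bar>\<close> keeps the constant nonnegative for every
  \<open>R\<close>.\<close>

lemma block_distance_bound:
  fixes v :: "'i \<Rightarrow> real"
  assumes J: "finite J" and \<omega>: "0 \<le> \<omega>" "L2_set v J \<le> \<omega>"
  obtains C where "0 \<le> C"
    "\<And>x. L2_set x J \<le> R \<Longrightarrow>
      (\<Sum>i\<in>J. (x i - (if \<omega> = 0 then x i else if L2_set v J < \<omega> then 0 else L2_set x J / \<omega> * v i))\<^sup>2)
        \<le> C * (\<omega> * L2_set x J - (\<Sum>i\<in>J. v i * x i))"
proof -
  have sq: "(\<Sum>i\<in>J. (y i)\<^sup>2) = (L2_set y J)\<^sup>2" for y :: "'i \<Rightarrow> real"
    by (simp add: L2_set_def sum_nonneg)
  have cs: "(\<Sum>i\<in>J. v i * x i) \<le> L2_set v J * L2_set x J" for x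
  proof -
    have "(\<Sum>i\<in>J. v i * x i) \<le> (\<Sum>i\<in>J. \<bar>v i\<bar> * \<bar>x i\<bar>)"
      by (intro sum_mono) (metis abs_ge_self abs_mult)
    then show ?thesis
      using L2_set_mult_ineq[of v x J] by linarith
  qed
  have D_nonneg: "0 \<le> \<omega> * L2_set x J - (\<Sum>i\<in>J. v i * x i)" for x
    using cs[of x] mult_right_mono[OF \<omega>(2) L2_set_nonneg[of x J]] by linarith
  consider (zero) "\<omega> = 0" | (strict) "\<omega> \<noteq> 0" "L2_set v J < \<omega>" | (tight) "\<omega> > 0" "L2_set v J = \<omega>"
    using \<omega> by fastforce
  then show ?thesis
  proof cases
    case zero
    then show ?thesis
      using D_nonneg by (intro that[of 0]) auto
  next
    case strict
    show ?thesis
    proof (rule that[of "\<bar>R\<bar> / (\<omega> - L2_set v J)"])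
      fix x
      assume R: "L2_set x J \<le> R"
      have "(\<omega> - L2_set v J) * (L2_set x J)\<^sup>2 \<le> (\<omega> - L2_set v J) * (\<bar>R\<bar> * L2_set x J)"
        using strict R unfolding power2_eq_square by (intro mult_left_mono mult_right_mono) auto
      also have "\<dots> = \<bar>R\<bar> * (\<omega> * L2_set x J - L2_set v J * L2_set x J)"
        by (simp add: algebra_simps)
      also have "\<dots> \<le> \<bar>R\<bar> * (\<omega> * L2_set x J - (\<Sum>i\<in>J. v i * x i))"
        using cs[of x] by (intro mult_left_mono) auto
      finally show "(\<Sum>i\<in>J. (x i - (if \<omega> = 0 then x i else if L2_set v J < \<omega> then 0
            else L2_set x J / \<omega> * v i))\<^sup>2)
          \<le> \<bar>R\<bar> / (\<omega> - L2_set v J) * (\<omega> * L2_set x J - (\<Sum>i\<in>J. v i * x i))"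
        using strict by (simp add: sq field_simps)
    qed (use strict in auto)
  next
    case tight
    show ?thesis
    proof (rule that[of "2 * \<bar>R\<bar> / \<omega>"])
      fix x
      assume R: "L2_set x J \<le> R"
      define r where "r = L2_set x J / \<omega>"
      have "(\<Sum>i\<in>J. (x i - r * v i)\<^sup>2)
          = (\<Sum>i\<in>J. (x i)\<^sup>2) - 2 * r * (\<Sum>i\<in>J. v i * x i) + r\<^sup>2 * (\<Sum>i\<in>J. (v i)\<^sup>2)"
        by (simp add: power2_diff sum.distrib sum_subtractf sum_distrib_left power_mult_distrib
            algebra_simps)
      also have "\<dots> = (L2_set x J)\<^sup>2 - 2 * r * (\<Sum>i\<in>J. v i * x i) + r\<^sup>2 * \<omega>\<^sup>2"
        by (simp only: sq tight)
      also have "\<dots> = 2 * r * (\<omega> * L2_set x J - (\<Sum>i\<in>J. v i * x i))"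
        using tight(1) by (simp add: r_def field_simps power2_eq_square)
      also have "\<dots> \<le> 2 * \<bar>R\<bar> / \<omega> * (\<omega> * L2_set x J - (\<Sum>i\<in>J. v i * x i))"
        using D_nonneg[of x] R tight(1) by (intro mult_right_mono) (auto simp: r_def field_simps)
      finally show "(\<Sum>i\<in>J. (x i - (if \<omega> = 0 then x i else if L2_set v J < \<omega> then 0
            else L2_set x J / \<omega> * v i))\<^sup>2)
          \<le> 2 * \<bar>R\<bar> / \<omega> * (\<omega> * L2_set x J - (\<Sum>i\<in>J. v i * x i))"
        using tight by (simp add: r_def)
    qed (use tight in auto)
  qed
qed

text \<open>The conjugate subdifferential of the group norm at \<open>v\<close> is the polyhedral cone
  \<open>{z \<in> V. \<forall>i. 0 \<le> v $ i * z $ i}\<close>: blocks with \<open>|v\<^sub>J| < \<omega>\<^sub>J\<close> vanish, blocks with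
  \<open>|v\<^sub>J| = \<omega>\<^sub>J > 0\<close> are nonnegative multiples of \<open>v\<^sub>J\<close>, and blocks with \<open>\<omega>\<^sub>J = 0\<close> are free.\<close>

lemma group_norm_face:
  fixes v :: "real ^ 'n"
  assumes part: "partition_on UNIV \<J>" and \<omega>: "\<And>J. J \<in> \<J> \<Longrightarrow> 0 \<le> \<omega> J"
    and v: "\<And>J. J \<in> \<J> \<Longrightarrow> L2_set (\<lambda>i. v $ i) J \<le> \<omega> J"
  obtains V where "subspace V"
    "\<And>z. z \<in> V \<Longrightarrow> (\<And>i. 0 \<le> v $ i * z $ i) \<Longrightarrow> group_norm \<J> \<omega> z = v \<bullet> z"
    "\<And>R. \<exists>C\<ge>0. \<forall>x. norm x \<le> R \<longrightarrow>
      (\<exists>p\<in>V. (\<forall>i. 0 \<le> v $ i * p $ i) \<and> (norm (x - p))\<^sup>2 \<le> C * (group_norm \<J> \<omega> x - v \<bullet> x))"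
proof -
  let ?n = "\<lambda>J (z :: real ^ 'n). L2_set (\<lambda>i. z $ i) J"
  \<comment> \<open>Being parallel to \<open>v\<close> on a block is expressed by vanishing
    two-by-two minors, which are linear in \<open>z\<close>; the sign conditions later single out
    the nonnegative multiples.\<close>
  define V where "V = {z :: real ^ 'n. \<forall>J\<in>\<J>. \<omega> J \<noteq> 0 \<longrightarrow>
    (\<forall>i\<in>J. (?n J v < \<omega> J \<longrightarrow> z $ i = 0) \<and> (\<forall>j\<in>J. z $ i * v $ j = z $ j * v $ i))}"
  have inner: "v \<bullet> z = (\<Sum>J\<in>\<J>. \<Sum>i\<in>J. v $ i * z $ i)" for z
    by (simp add: inner_vec_def sum_UNIV_partition[OF part])
  have v0: "v $ i = 0" if "J \<in> \<J>" "i \<in> J" "\<omega> J = 0" for i J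
    using v[OF that(1)] L2_set_eq_0_iff[of J "\<lambda>i. v $ i"] that L2_set_nonneg[of "\<lambda>i. v $ i" J]
    by force
  have "subspace V"
    unfolding V_def by (rule subspaceI) (auto simp: algebra_simps)
  moreover have "group_norm \<J> \<omega> z = v \<bullet> z" if z: "z \<in> V" "\<And>i. 0 \<le> v $ i * z $ i" for z
  proof -
    have "\<omega> J * ?n J z = (\<Sum>i\<in>J. v $ i * z $ i)" if J: "J \<in> \<J>" for J
    proof -
      consider "\<omega> J = 0" | "\<omega> J \<noteq> 0" "?n J v < \<omega> J" | "\<omega> J \<noteq> 0" "?n J v = \<omega> J"
        using v[OF J] by fastforce
      then show ?thesis
      proof cases
        case 1
        then show ?thesis
          using v0[OF J] by simp
      next
        case 2
        then have "\<forall>i\<in>J. z $ i = 0"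
          using z(1) J by (auto simp: V_def)
        then show ?thesis
          by (simp add: L2_set_def)
      next
        case 3
        \<comment> \<open>Equality case of Cauchy-Schwarz: the vanishing minors let the double sum
          factor, and nonnegativity of the summands allows taking square roots.\<close>
        have "(\<Sum>i\<in>J. v $ i * z $ i)\<^sup>2 = (\<Sum>i\<in>J. \<Sum>j\<in>J. (v $ i * z $ i) * (v $ j * z $ j))"
          by (simp add: power2_eq_square sum_product)
        also have "\<dots> = (\<Sum>i\<in>J. \<Sum>j\<in>J. (v $ i)\<^sup>2 * (z $ j)\<^sup>2)"
        proof (intro sum.cong refl)
          fix i j
          assume "i \<in> J" "j \<in> J"
          then have "z $ i * v $ j = z $ j * v $ i"
            using z(1) J 3 by (auto simp: V_def)
          then show "(v $ i * z $ i) * (v $ j * z $ j) = (v $ i)\<^sup>2 * (z $ j)\<^sup>2"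
            by (simp add: power2_eq_square)
        qed
        also have "\<dots> = (\<Sum>i\<in>J. (v $ i)\<^sup>2) * (\<Sum>j\<in>J. (z $ j)\<^sup>2)"
          by (simp add: sum_product)
        also have "\<dots> = (?n J v)\<^sup>2 * (?n J z)\<^sup>2"
          by (simp add: L2_set_def sum_nonneg)
        also have "\<dots> = (\<omega> J * ?n J z)\<^sup>2"
          by (simp only: 3(2) power_mult_distrib)
        finally show ?thesis
          using z(2) \<omega>[OF J] L2_set_nonneg
          by (metis mult_nonneg_nonneg power2_eq_iff_nonneg sum_nonneg)
      qed
    qed
    then show ?thesis
      by (simp add: group_norm_def inner)
  qed
  moreover have "\<exists>C\<ge>0. \<forall>x. norm x \<le> R \<longrightarrow>
      (\<exists>p\<in>V. (\<forall>i. 0 \<le> v $ i * p $ i) \<and> (norm (x - p))\<^sup>2 \<le> C * (group_norm \<J> \<omega> x - v \<bullet> x))" for R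
  proof -
    define b where "b J x i = (if \<omega> J = 0 then x $ i else if ?n J v < \<omega> J then 0
      else ?n J x / \<omega> J * v $ i)" for J and x :: "real ^ 'n" and i
    define D where "D J x = \<omega> J * ?n J x - (\<Sum>i\<in>J. v $ i * x $ i)" for J x
    have "\<exists>C\<ge>0. J \<in> \<J> \<longrightarrow> (\<forall>x. ?n J x \<le> R \<longrightarrow> (\<Sum>i\<in>J. (x $ i - b J x i)\<^sup>2) \<le> C * D J x)" for J
    proof (cases "J \<in> \<J>")
      case True
      from block_distance_bound[of J "\<omega> J" "\<lambda>i. v $ i" R, OF _ \<omega>[OF True] v[OF True]]
      obtain C where "0 \<le> C" "\<And>x. L2_set x J \<le> R \<Longrightarrow>
        (\<Sum>i\<in>J. (x i - (if \<omega> J = 0 then x i else if ?n J v < \<omega> J then 0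
          else L2_set x J / \<omega> J * v $ i))\<^sup>2) \<le> C * (\<omega> J * L2_set x J - (\<Sum>i\<in>J. v $ i * x i))"
        by auto
      then show ?thesis
        by (intro exI[of _ C]) (auto simp: b_def D_def)
    qed auto
    then obtain c where c: "\<And>J. 0 \<le> c J"
      "\<And>J x. J \<in> \<J> \<Longrightarrow> ?n J x \<le> R \<Longrightarrow> (\<Sum>i\<in>J. (x $ i - b J x i)\<^sup>2) \<le> c J * D J x"
      by metis
    \<comment> \<open>The sum dominates each \<open>c J\<close>, and every block gap
      \<open>D J x\<close> is nonnegative, so a single constant works for all blocks.\<close>
    define C where "C = (\<Sum>J\<in>\<J>. c J)"
    have "\<exists>p\<in>V. (\<forall>i. 0 \<le> v $ i * p $ i) \<and> (norm (x - p))\<^sup>2 \<le> C * (group_norm \<J> \<omega> x - v \<bullet> x)"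
      if x: "norm x \<le> R" for x
    proof -
      have ex: "\<exists>J\<in>\<J>. i \<in> J" for i
        using partition_onD1[OF part] by auto
      then obtain B where B: "\<And>i. B i \<in> \<J>" "\<And>i. i \<in> B i"
        by metis
      have B_eq: "B i = J" if "J \<in> \<J>" "i \<in> J" for i J
        using partition_onD2[OF part] B[of i] that by (auto simp: disjoint_def)
      define p where "p = (\<chi> i. b (B i) x i)"
      have p_eq: "p $ i = b J x i" if "J \<in> \<J>" "i \<in> J" for i J
        using B_eq[OF that] by (simp add: p_def)
      have "p \<in> V"
        unfolding V_def using v by (auto simp: p_eq b_def)
      moreover have "0 \<le> v $ i * p $ i" for i
      proof -
        have "0 \<le> ?n (B i) x / \<omega> (B i) * (v $ i)\<^sup>2"
          using \<omega>[OF B(1)] by simp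
        then show ?thesis
          using v0[OF B[of i]] by (auto simp: p_def b_def power2_eq_square mult.left_commute)
      qed
      moreover have "(norm (x - p))\<^sup>2 \<le> C * (group_norm \<J> \<omega> x - v \<bullet> x)"
      proof -
        have n_le: "?n J x \<le> R" for J
        proof -
          have "?n J x \<le> norm x"
            unfolding norm_vec_def L2_set_def
            by (intro real_sqrt_le_mono) (simp add: sum_mono2)
          with x show ?thesis
            by simp
        qed
        have D_nonneg: "0 \<le> D J x" if "J \<in> \<J>" for J
        proof -
          have "(\<Sum>i\<in>J. v $ i * x $ i) \<le> (\<Sum>i\<in>J. \<bar>v $ i\<bar> * \<bar>x $ i\<bar>)"
            by (intro sum_mono) (metis abs_ge_self abs_mult)
          also have "\<dots> \<le> ?n J v * ?n J x"
            by (rule L2_set_mult_ineq)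
          also have "\<dots> \<le> \<omega> J * ?n J x"
            by (intro mult_right_mono v that) simp
          finally show ?thesis
            by (simp add: D_def)
        qed
        have "(norm (x - p))\<^sup>2 = (\<Sum>J\<in>\<J>. \<Sum>i\<in>J. (x $ i - p $ i)\<^sup>2)"
          by (simp add: norm_vec_def L2_set_def sum_nonneg sum_UNIV_partition[OF part])
        also have "\<dots> = (\<Sum>J\<in>\<J>. \<Sum>i\<in>J. (x $ i - b J x i)\<^sup>2)"
          by (simp add: p_eq)
        also have "\<dots> \<le> (\<Sum>J\<in>\<J>. C * D J x)"
        proof (rule sum_mono)
          fix J
          assume J: "J \<in> \<J>"
          have "(\<Sum>i\<in>J. (x $ i - b J x i)\<^sup>2) \<le> c J * D J x"
            by (rule c(2)[OF J n_le])
          also have "\<dots> \<le> C * D J x"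
            unfolding C_def using J
            by (intro mult_right_mono D_nonneg member_le_sum) (auto simp: c(1))
          finally show "(\<Sum>i\<in>J. (x $ i - b J x i)\<^sup>2) \<le> C * D J x" .
        qed
        also have "\<dots> = C * (group_norm \<J> \<omega> x - v \<bullet> x)"
          by (simp add: D_def group_norm_def inner sum_subtractf sum_distrib_left[symmetric])
        finally show ?thesis .
      qed
      ultimately show ?thesis
        by blast
    qed
    moreover have "0 \<le> C"
      by (simp add: C_def sum_nonneg c(1))
    ultimately show ?thesis
      by blast
  qed
  ultimately show ?thesis
    by (rule that)
qed

section \<open>Convexity of the smooth part and quadratic growth of the objective\<close>

lemma convex_on_gradient_inequality:
  fixes f :: "'a::real_inner \<Rightarrow> real"
  assumes "\<And>x y. f x + G x \<bullet> (y - x) \<le> f y"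
  shows "convex_on UNIV f"
proof (intro convex_onI)
  fix t :: real and x y :: 'a
  assume t: "0 < t" "t < 1"
  define z where "z = (1 - t) *\<^sub>R x + t *\<^sub>R y"
  have "(1 - t) * (f z + G z \<bullet> (x - z)) + t * (f z + G z \<bullet> (y - z)) \<le> (1 - t) * f x + t * f y"
    using t by (intro add_mono mult_left_mono assms) auto
  moreover have "(1 - t) * (G z \<bullet> (x - z)) + t * (G z \<bullet> (y - z))
      = G z \<bullet> ((1 - t) *\<^sub>R (x - z) + t *\<^sub>R (y - z))"
    by (simp add: inner_add_right)
  moreover have "(1 - t) *\<^sub>R (x - z) + t *\<^sub>R (y - z) = 0"
    by (simp add: z_def algebra_simps)
  ultimately show "f ((1 - t) *\<^sub>R x + t *\<^sub>R y) \<le> (1 - t) * f x + t * f y"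
    by (simp add: z_def algebra_simps)
qed simp

text \<open>Strong convexity of \<open>h\<close> between \<open>A x\<close> and \<open>A y\<close>
  is differentiated along the segment at \<open>x\<close>. The modulus measures only
  \<open>A y - A x\<close>, so directions in the kernel of \<open>A\<close> gain nothing.\<close>

lemma strongly_convex_composition_gradient:
  fixes A :: "'a::real_inner \<Rightarrow> 'b::real_normed_vector" and h :: "'b \<Rightarrow> ereal"
  assumes A: "linear A" and sc: "strongly_convex_on (A ` S) h"
    and h_eq: "\<And>z. h (A z) = ereal (\<phi> z)"
    and deriv: "\<And>z. GDERIV (\<lambda>z. \<phi> z + q \<bullet> z) z :> G z"
  obtains \<mu> where "0 < \<mu>"
    "\<And>x y. x \<in> S \<Longrightarrow> y \<in> S \<Longrightarrow>
      \<phi> x + q \<bullet> x + G x \<bullet> (y - x) + \<mu> / 2 * (norm (A y - A x))\<^sup>2 \<le> \<phi> y + q \<bullet> y"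
proof -
  from sc obtain \<mu> where \<mu>: "0 < \<mu>" and ineq: "\<And>x y t. x \<in> S \<Longrightarrow> y \<in> S \<Longrightarrow> t \<in> {0..1} \<Longrightarrow>
      h ((1 - t) *\<^sub>R A x + t *\<^sub>R A y) \<le> ereal (1 - t) * h (A x) + ereal t * h (A y)
        - ereal (\<mu> / 2 * t * (1 - t) * (norm (A x - A y))\<^sup>2)"
    unfolding strongly_convex_on_def by blast
  have "\<phi> x + q \<bullet> x + G x \<bullet> (y - x) + \<mu> / 2 * (norm (A y - A x))\<^sup>2 \<le> \<phi> y + q \<bullet> y"
    if xy: "x \<in> S" "y \<in> S" for x y
  proof -
    let ?m = "\<mu> / 2 * (norm (A x - A y))\<^sup>2"
    \<comment> \<open>As \<open>t * (1 - t) = t - t\<^sup>2\<close>, the strong convexity term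
      splits into the slope \<open>- ?m\<close> and a quadratic remainder, which the limit
      removes.\<close>
    have "G x \<bullet> (y - x) \<le> \<phi> y + q \<bullet> y - (\<phi> x + q \<bullet> x) - ?m"
      using deriv[of x]
    proof (rule GDERIV_direction_le[where M = ?m])
      fix t :: real
      assume t: "0 < t" "t \<le> 1"
      have "x + t *\<^sub>R (y - x) = (1 - t) *\<^sub>R x + t *\<^sub>R y"
        by (simp add: algebra_simps)
      then have "A (x + t *\<^sub>R (y - x)) = (1 - t) *\<^sub>R A x + t *\<^sub>R A y"
        by (simp add: linear_add[OF A] linear_scale[OF A])
      then have "h ((1 - t) *\<^sub>R A x + t *\<^sub>R A y) = ereal (\<phi> (x + t *\<^sub>R (y - x)))"
        using h_eq by metis
      then have "\<phi> (x + t *\<^sub>R (y - x)) \<le> (1 - t) * \<phi> x + t * \<phi> y - \<mu> / 2 * t * (1 - t) * (norm (A x - A y))\<^sup>2"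
        using ineq[OF xy, of t] t by (simp add: h_eq)
      then show "\<phi> (x + t *\<^sub>R (y - x)) + q \<bullet> (x + t *\<^sub>R (y - x))
          \<le> \<phi> x + q \<bullet> x + t * (\<phi> y + q \<bullet> y - (\<phi> x + q \<bullet> x) - ?m) + t\<^sup>2 * ?m"
        by (simp add: inner_add_right inner_diff_right algebra_simps power2_eq_square diff_divide_distrib)
    qed
    then show ?thesis
      by (simp add: norm_minus_commute)
  qed
  with \<mu> show ?thesis
    by (rule that)
qed

text \<open>The gap controls both the distance from \<open>z\<close> to a cone point
  \<open>p\<close> and the residual \<open>A z - A xs\<close>. Hoffman's bound moves
  \<open>p\<close> to an optimal \<open>w\<close>, and triangle inequalities combine the two
  distances. The hypothesis \<open>affine\<close> records that \<open>f\<close> is a function of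
  \<open>A z\<close> plus a linear term.\<close>

lemma quadratic_growth:
  fixes A :: "real ^ 'n \<Rightarrow> 'b::real_normed_vector" and f :: "real ^ 'n \<Rightarrow> real"
  assumes part: "partition_on UNIV \<J>" and \<omega>: "\<And>J. J \<in> \<J> \<Longrightarrow> 0 \<le> \<omega> J"
    and A: "bounded_linear A" and deriv: "GDERIV f xs :> G"
    and min: "\<And>z. f xs + group_norm \<J> \<omega> xs \<le> f z + group_norm \<J> \<omega> z"
    and affine: "\<And>z. A z = A xs \<Longrightarrow> f z = f xs + q \<bullet> (z - xs)"
    and \<mu>: "0 < \<mu>"
    and sc: "\<And>z. norm z \<le> R \<Longrightarrow> f xs + G \<bullet> (z - xs) + \<mu> / 2 * (norm (A z - A xs))\<^sup>2 \<le> f z"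
  obtains c where "0 < c"
    "\<And>z. norm z \<le> R \<Longrightarrow> \<exists>w. f w + group_norm \<J> \<omega> w = f xs + group_norm \<J> \<omega> xs \<and>
      c * (norm (z - w))\<^sup>2 \<le> f z + group_norm \<J> \<omega> z - (f xs + group_norm \<J> \<omega> xs)"
proof -
  let ?g = "group_norm \<J> \<omega>"
  interpret A: bounded_linear A
    by (rule A)
  define v where "v = - G"
  \<comment> \<open>Optimality of \<open>xs\<close> makes \<open>- G\<close> a subgradient of the
    group norm there.\<close>
  have sub: "?g xs + v \<bullet> (z - xs) \<le> ?g z" for z
  proof -
    have "- (G \<bullet> (z - xs)) \<le> ?g z - ?g xs"
      using deriv
    proof (rule GDERIV_minus_direction_le)
      fix t :: real
      assume t: "0 < t" "t \<le> 1"
      have "?g (xs + t *\<^sub>R (z - xs)) \<le> (1 - t) * ?g xs + t * ?g z"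
        using convex_onD[OF convex_on_group_norm[of \<J> \<omega>], of t xs z] \<omega> t
        by (simp add: algebra_simps)
      with min[of "xs + t *\<^sub>R (z - xs)"]
      show "f xs \<le> f (xs + t *\<^sub>R (z - xs)) + t * (?g z - ?g xs)"
        by (simp add: algebra_simps)
    qed
    then show ?thesis
      by (simp add: v_def)
  qed
  note gxs = subgradient_group_norm(1)[OF part \<omega> sub]
  note v_le = subgradient_group_norm(2)[OF part \<omega> sub]
  obtain V where V: "subspace V"
    and face: "\<And>z. z \<in> V \<Longrightarrow> (\<And>i. 0 \<le> v $ i * z $ i) \<Longrightarrow> ?g z = v \<bullet> z"
    and near: "\<And>R. \<exists>C\<ge>0. \<forall>x. norm x \<le> R \<longrightarrow>
      (\<exists>p\<in>V. (\<forall>i. 0 \<le> v $ i * p $ i) \<and> (norm (x - p))\<^sup>2 \<le> C * (?g x - v \<bullet> x))"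
    using group_norm_face[OF part \<omega> v_le] by blast
  \<comment> \<open>The gap of the group norm at \<open>xs\<close> is zero, so its nearby cone point
    is \<open>xs\<close> itself; this makes the Hoffman system feasible.\<close>
  have xs: "xs \<in> V" "\<And>i. 0 \<le> v $ i * xs $ i"
  proof -
    obtain p where "p \<in> V" "\<forall>i. 0 \<le> v $ i * p $ i" "(norm (xs - p))\<^sup>2 \<le> 0"
      using near[of "norm xs"] gxs by fastforce
    then show "xs \<in> V" "\<And>i. 0 \<le> v $ i * xs $ i"
      by auto
  qed
  \<comment> \<open>Along \<open>w - xs\<close> the function \<open>f\<close> is affine, so its
    slope \<open>q \<bullet> (w - xs)\<close> equals \<open>G \<bullet> (w - xs)\<close>. The change
    of \<open>f\<close> then cancels that of the group norm, which agrees with \<open>v\<close> on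
    the cone.\<close>
  have optimal: "f w + ?g w = f xs + ?g xs"
    if w: "w \<in> V" "\<And>i. 0 \<le> v $ i * w $ i" "A w = A xs" for w
  proof -
    have line: "f (xs + t *\<^sub>R (w - xs)) = f xs + t * (q \<bullet> (w - xs))" for t
      using affine[of "xs + t *\<^sub>R (w - xs)"] w(3) by (simp add: A.add A.scaleR A.diff)
    have "G \<bullet> (w - xs) \<le> q \<bullet> (w - xs)"
      by (rule GDERIV_direction_le[OF deriv, where M = 0]) (simp add: line)
    moreover have "- (G \<bullet> (w - xs)) \<le> - (q \<bullet> (w - xs))"
      by (rule GDERIV_minus_direction_le[OF deriv]) (simp add: line)
    ultimately have "f w = f xs - v \<bullet> (w - xs)"
      using affine[OF w(3)] by (simp add: v_def)
    then show ?thesis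
      using face[OF w(1,2)] gxs by (simp add: inner_diff_right)
  qed
  obtain \<kappa> where \<kappa>: "0 \<le> \<kappa>" and hoffman: "\<And>p. p \<in> V \<Longrightarrow> (\<forall>i. 0 \<le> v $ i * p $ i) \<Longrightarrow>
    \<exists>w\<in>V. (\<forall>i. 0 \<le> v $ i * w $ i) \<and> A w = A xs \<and> norm (p - w) \<le> \<kappa> * norm (A p - A xs)"
    using hoffman_bound[OF A V xs] by blast
  obtain C where C: "0 \<le> C" and proj: "\<And>x. norm x \<le> R \<Longrightarrow>
      \<exists>p\<in>V. (\<forall>i. 0 \<le> v $ i * p $ i) \<and> (norm (x - p))\<^sup>2 \<le> C * (?g x - v \<bullet> x)"
    using near[of R] by blast
  obtain K where K: "0 < K" "\<And>z. norm (A z) \<le> norm z * K"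
    using A.pos_bounded by blast
  have sum_sq: "(a + b)\<^sup>2 \<le> 2 * a\<^sup>2 + 2 * b\<^sup>2" for a b :: real
    using zero_le_power2[of "a - b"] by (simp add: power2_eq_square algebra_simps)
  \<comment> \<open>Collects the constants from applying \<open>sum_sq\<close> twice: to
    \<open>z - w\<close> split at \<open>p\<close>, and to the residual of \<open>p\<close> split at
    \<open>z\<close>. Dividing by \<open>M + 1\<close> later avoids a zero denominator.\<close>
  define M where "M = 2 * C + 2 * \<kappa>\<^sup>2 * (2 * (2 / \<mu>) + 2 * K\<^sup>2 * C)"
  have M: "0 \<le> M"
    using C \<mu> by (simp add: M_def)
  have "\<exists>w. f w + ?g w = f xs + ?g xs \<and> 1 / (M + 1) * (norm (z - w))\<^sup>2 \<le> f z + ?g z - (f xs + ?g xs)"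
    if z: "norm z \<le> R" for z
  proof -
    define \<Delta> where "\<Delta> = f z + ?g z - (f xs + ?g xs)"
    have bregman: "\<mu> / 2 * (norm (A z - A xs))\<^sup>2 + (?g z - v \<bullet> z) \<le> \<Delta>"
      using sc[OF z] gxs by (simp add: \<Delta>_def v_def inner_diff_right)
    have "?g z - v \<bullet> z \<ge> 0"
      using sub[of z] gxs by (simp add: inner_diff_right)
    then have Az: "(norm (A z - A xs))\<^sup>2 \<le> 2 / \<mu> * \<Delta>"
      using bregman \<mu> by (simp add: field_simps)
    have gz: "?g z - v \<bullet> z \<le> \<Delta>"
      using bregman \<mu> by (smt (verit) divide_nonneg_nonneg mult_nonneg_nonneg zero_le_power2)
    obtain p where p: "p \<in> V" "\<forall>i. 0 \<le> v $ i * p $ i" "(norm (z - p))\<^sup>2 \<le> C * (?g z - v \<bullet> z)"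
      using proj[OF z] by blast
    have zp: "(norm (z - p))\<^sup>2 \<le> C * \<Delta>"
      using p(3) mult_left_mono[OF gz C] by linarith
    obtain w where w: "w \<in> V" "\<forall>i. 0 \<le> v $ i * w $ i" "A w = A xs"
      "norm (p - w) \<le> \<kappa> * norm (A p - A xs)"
      using hoffman[OF p(1,2)] by blast
    have "norm (A p - A xs) \<le> norm (A z - A xs) + norm (A (p - z))"
      using norm_triangle_ineq[of "A z - A xs" "A (p - z)"] by (simp add: A.diff)
    also have "\<dots> \<le> norm (A z - A xs) + K * norm (z - p)"
      using K(2)[of "p - z"] by (simp add: norm_minus_commute mult.commute)
    finally have "(norm (A p - A xs))\<^sup>2 \<le> (norm (A z - A xs) + K * norm (z - p))\<^sup>2"
      by (simp add: power_mono)
    also have "\<dots> \<le> 2 * (norm (A z - A xs))\<^sup>2 + 2 * K\<^sup>2 * (norm (z - p))\<^sup>2"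
      using sum_sq[of "norm (A z - A xs)" "K * norm (z - p)"] by (simp add: power_mult_distrib)
    also have "\<dots> \<le> 2 * (2 / \<mu> * \<Delta>) + 2 * K\<^sup>2 * (C * \<Delta>)"
      using Az zp by (intro add_mono mult_left_mono) auto
    also have "\<dots> = (2 * (2 / \<mu>) + 2 * K\<^sup>2 * C) * \<Delta>"
      by (simp add: algebra_simps)
    finally have Ap: "(norm (A p - A xs))\<^sup>2 \<le> (2 * (2 / \<mu>) + 2 * K\<^sup>2 * C) * \<Delta>" .
    have "(norm (p - w))\<^sup>2 \<le> (\<kappa> * norm (A p - A xs))\<^sup>2"
      using w(4) by (simp add: power_mono)
    also have "\<dots> \<le> \<kappa>\<^sup>2 * ((2 * (2 / \<mu>) + 2 * K\<^sup>2 * C) * \<Delta>)"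
      unfolding power_mult_distrib by (intro mult_left_mono Ap) simp
    finally have pw: "(norm (p - w))\<^sup>2 \<le> \<kappa>\<^sup>2 * ((2 * (2 / \<mu>) + 2 * K\<^sup>2 * C) * \<Delta>)" .
    have "norm (z - w) \<le> norm (z - p) + norm (p - w)"
      using norm_triangle_ineq[of "z - p" "p - w"] by simp
    then have "(norm (z - w))\<^sup>2 \<le> (norm (z - p) + norm (p - w))\<^sup>2"
      by (simp add: power_mono)
    also have "\<dots> \<le> 2 * (norm (z - p))\<^sup>2 + 2 * (norm (p - w))\<^sup>2"
      by (rule sum_sq)
    also have "\<dots> \<le> 2 * (C * \<Delta>) + 2 * (\<kappa>\<^sup>2 * ((2 * (2 / \<mu>) + 2 * K\<^sup>2 * C) * \<Delta>))"
      using zp pw by (intro add_mono mult_left_mono) auto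
    also have "\<dots> = M * \<Delta>"
      by (simp add: M_def algebra_simps)
    also have "\<dots> \<le> (M + 1) * \<Delta>"
      using min[of z] by (intro mult_right_mono) (auto simp: \<Delta>_def)
    finally have "1 / (M + 1) * (norm (z - w))\<^sup>2 \<le> \<Delta>"
      using M by (simp add: field_simps)
    moreover have "f w + ?g w = f xs + ?g xs"
      using w(1-3) by (intro optimal) auto
    ultimately show ?thesis
      unfolding \<Delta>_def by blast
  qed
  moreover have "0 < 1 / (M + 1)"
    using M by simp
  ultimately show ?thesis
    by (intro that[of "1 / (M + 1)"])
qed

section \<open>From quadratic growth to linear convergence\<close>

lemma linear_convergence_of_quadratic_growth:
  fixes x :: "nat \<Rightarrow> 'a::{real_inner,banach}" and \<Phi> :: "'a \<Rightarrow> real"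
  assumes conv: "convex_on UNIV \<Phi>" and cont: "continuous_on UNIV \<Phi>"
    and \<gamma>: "0 < \<gamma>" and c: "0 < c" and lower: "\<And>z. m \<le> \<Phi> z"
    and step: "\<And>k z. \<Phi> (x (Suc k))
      \<le> \<Phi> z + 1 / (2 * \<gamma>) * ((norm (z - x k))\<^sup>2 - (norm (z - x (Suc k)))\<^sup>2)"
    and growth: "\<And>k. \<exists>w. \<Phi> w = m \<and> c * (norm (x k - w))\<^sup>2 \<le> \<Phi> (x k) - m"
  obtains l \<sigma> \<rho>0 \<rho> where "\<Phi> l = m" "0 < \<sigma>" "\<sigma> < 1" "0 < \<rho>0" "0 < \<rho>" "\<rho> < 1"
    "\<And>k. \<Phi> (x (Suc k)) - m \<le> \<sigma> * (\<Phi> (x k) - m)"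
    "\<And>k. norm (x k - l) \<le> \<rho>0 * \<rho> ^ k"
proof -
  \<comment> \<open>The step inequality is tested at weight \<open>t\<close> towards
    \<open>w\<close>. Convexity removes a fraction \<open>t\<close> of the gap, and the proximity
    term returns at most \<open>t / 2\<close> of it because \<open>t \<le> \<gamma> * c\<close>;
    this gives \<sigma>.\<close>
  define t where "t = min 1 (\<gamma> * c)"
  define \<sigma> where "\<sigma> = 1 - t / 2"
  have t: "0 < t" "t \<le> 1" "t \<le> \<gamma> * c"
    using \<gamma> c by (auto simp: t_def)
  have \<sigma>: "0 < \<sigma>" "\<sigma> < 1"
    using t by (auto simp: \<sigma>_def)
  have dec: "\<Phi> (x (Suc k)) - m \<le> \<sigma> * (\<Phi> (x k) - m)" for k
  proof -
    obtain w where w: "\<Phi> w = m" "c * (norm (x k - w))\<^sup>2 \<le> \<Phi> (x k) - m"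
      using growth by blast
    define z where "z = (1 - t) *\<^sub>R x k + t *\<^sub>R w"
    have "z - x k = t *\<^sub>R (w - x k)"
      by (simp add: z_def algebra_simps)
    then have nz: "(norm (z - x k))\<^sup>2 = t\<^sup>2 * (norm (x k - w))\<^sup>2"
      by (simp add: power_mult_distrib norm_minus_commute)
    have "\<Phi> (x (Suc k)) \<le> \<Phi> z + 1 / (2 * \<gamma>) * ((norm (z - x k))\<^sup>2 - (norm (z - x (Suc k)))\<^sup>2)"
      by (rule step)
    also have "\<dots> \<le> \<Phi> z + 1 / (2 * \<gamma>) * (norm (z - x k))\<^sup>2"
      using \<gamma> by (simp add: field_simps)
    also have "\<Phi> z \<le> (1 - t) * \<Phi> (x k) + t * m"
      using convex_onD[OF conv, of t "x k" w] t w(1) by (simp add: z_def)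
    also have "1 / (2 * \<gamma>) * (norm (z - x k))\<^sup>2 \<le> t / 2 * (\<Phi> (x k) - m)"
    proof -
      have "1 / (2 * \<gamma>) * (norm (z - x k))\<^sup>2 = t / 2 * (t / \<gamma> * (norm (x k - w))\<^sup>2)"
        unfolding nz using \<gamma> by (simp add: field_simps power2_eq_square)
      also have "\<dots> \<le> t / 2 * (c * (norm (x k - w))\<^sup>2)"
        using t \<gamma> by (intro mult_left_mono mult_right_mono) (auto simp: field_simps)
      also have "\<dots> \<le> t / 2 * (\<Phi> (x k) - m)"
        using t w(2) by (intro mult_left_mono) auto
      finally show ?thesis .
    qed
    finally show ?thesis
      by (simp add: \<sigma>_def field_simps)
  qed
  have geometric: "\<Phi> (x k) - m \<le> \<sigma> ^ k * (\<Phi> (x 0) - m)" for k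
  proof (induction k)
    case (Suc k)
    then have "\<sigma> * (\<Phi> (x k) - m) \<le> \<sigma> * (\<sigma> ^ k * (\<Phi> (x 0) - m))"
      using \<sigma> by (intro mult_left_mono) auto
    with dec[of k] show ?case
      by simp
  qed simp
  \<comment> \<open>Squared step lengths are bounded by a multiple of the gap, so the iterates
    inherit the square root of its rate.\<close>
  define \<rho> where "\<rho> = sqrt \<sigma>"
  have \<rho>: "0 < \<rho>" "\<rho> < 1"
    using \<sigma> by (auto simp: \<rho>_def)
  define M where "M = sqrt (2 * \<gamma> * (\<Phi> (x 0) - m))"
  have "norm (x (Suc k) - x k) \<le> M * \<rho> ^ k" for k
  proof (rule power2_le_imp_le)
    have "\<Phi> (x (Suc k)) \<le> \<Phi> (x k) - 1 / (2 * \<gamma>) * (norm (x (Suc k) - x k))\<^sup>2"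
      using step[of k "x k"] by (simp add: norm_minus_commute)
    then have "1 / (2 * \<gamma>) * (norm (x (Suc k) - x k))\<^sup>2 \<le> \<sigma> ^ k * (\<Phi> (x 0) - m)"
      using geometric[of k] lower[of "x (Suc k)"] by linarith
    then have "(norm (x (Suc k) - x k))\<^sup>2 \<le> 2 * \<gamma> * (\<Phi> (x 0) - m) * \<sigma> ^ k"
      using \<gamma> by (simp add: field_simps)
    also have "\<dots> = (M * \<rho> ^ k)\<^sup>2"
    proof -
      have "(\<rho> ^ k)\<^sup>2 = \<sigma> ^ k"
        using \<sigma> by (simp add: \<rho>_def power_mult[symmetric] mult.commute[of k] power_mult)
      moreover have "M\<^sup>2 = 2 * \<gamma> * (\<Phi> (x 0) - m)"
        using \<gamma> lower[of "x 0"] by (simp add: M_def)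
      ultimately show ?thesis
        by (simp only: power_mult_distrib)
    qed
    finally show "(norm (x (Suc k) - x k))\<^sup>2 \<le> (M * \<rho> ^ k)\<^sup>2" .
    show "0 \<le> M * \<rho> ^ k"
      using \<rho> \<gamma> lower[of "x 0"] by (simp add: M_def)
  qed
  then obtain l where l: "x \<longlonglongrightarrow> l" "\<And>k. norm (x k - l) \<le> M / (1 - \<rho>) * \<rho> ^ k"
    using geometric_increments_converge[of x M \<rho>] \<rho> by auto
  have "\<Phi> l = m"
  proof (rule antisym)
    have "(\<lambda>k. \<Phi> (x k)) \<longlonglongrightarrow> \<Phi> l"
      using cont l(1) by (auto simp: continuous_on_eq_continuous_at intro: isCont_tendsto_compose)
    moreover have "(\<lambda>k. m + \<sigma> ^ k * (\<Phi> (x 0) - m)) \<longlonglongrightarrow> m + 0 * (\<Phi> (x 0) - m)"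
      using \<sigma> by (intro tendsto_intros LIMSEQ_power_zero) auto
    moreover have "\<Phi> (x k) \<le> m + \<sigma> ^ k * (\<Phi> (x 0) - m)" for k
      using geometric[of k] by simp
    ultimately show "\<Phi> l \<le> m"
      using LIMSEQ_le by fastforce
  qed (rule lower)
  \<comment> \<open>Adding 1 keeps the constant strictly positive even if the initial gap, and hence
    \<open>M\<close>, is 0.\<close>
  moreover have "norm (x k - l) \<le> (M / (1 - \<rho>) + 1) * \<rho> ^ k" for k
    using l(2)[of k] \<rho> by (simp add: distrib_right add_increasing2)
  moreover have "0 < M / (1 - \<rho>) + 1"
    using \<rho> \<gamma> lower[of "x 0"] by (simp add: M_def add_nonneg_pos)
  ultimately show ?thesis
    using \<sigma> \<rho> dec by (intro that[of l \<sigma> "M / (1 - \<rho>) + 1" \<rho>])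
qed

section \<open>Gradients of extended-real functions and the convergence theorem\<close>

lemma egrad_eq:
  assumes "has_egrad f x d"
  shows "egrad f x = d"
  unfolding egrad_def
proof (rule the_equality)
  fix d'
  assume "has_egrad f x d'"
  with assms have "(\<lambda>h. h \<bullet> d') = (\<lambda>h. h \<bullet> d)"
    unfolding has_egrad_def gderiv_def by (blast intro: has_derivative_unique)
  then have "(d' - d) \<bullet> d' = (d' - d) \<bullet> d"
    by (rule fun_cong)
  then have "(d' - d) \<bullet> (d' - d) = 0"
    by (simp only: inner_diff_right)
  then show "d' = d"
    by simp
qed (rule assms)

theorem proposition5p1:
  fixes A :: "real ^ 'n ^ 'm" and q :: "real ^ 'n"
    and h :: "real ^ 'm \<Rightarrow> ereal"
    and f g F :: "real ^ 'n \<Rightarrow> ereal"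
    and \<J> :: "'n set set" and \<omega> :: "'n set \<Rightarrow> real"
    and C :: "(real ^ 'n) set" and L \<gamma> Fmin :: real
    and x :: "nat \<Rightarrow> real ^ 'n"
  assumes f_eq: "f = (\<lambda>z. h (A *v z) + ereal (q \<bullet> z))"
    and h_closed: "closed_fun h" and h_proper: "proper h" and h_convex: "convex_fun h"
    and h_open: "open (edom h)"
    and h_C1: "C1_fun_on (edom h) h"
    and h_strong: "\<And>K. compact K \<Longrightarrow> convex K \<Longrightarrow> K \<subseteq> edom h \<Longrightarrow> strongly_convex_on K h"
    and \<J>_partition: "partition_on UNIV \<J>"
    and \<omega>_nonneg: "\<And>J. J \<in> \<J> \<Longrightarrow> 0 \<le> \<omega> J"
    and g_eq: "g = group_lasso \<J> \<omega>"
    and F_eq: "F = (\<lambda>z. f z + g z)"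
    and f_proper: "proper f" and f_lsc: "lsc f"
    and f_open: "open (edom f)" and f_smooth: "C1_fun_on (edom f) f"
    and L_pos: "0 < L"
    and C_closed: "closed C" and C_dom: "edom f \<inter> edom g \<subseteq> C"
    and grad_Lipschitz: "ediff_on C f" "L-lipschitz_on C (egrad f)"
    and F_lower: "\<And>z. ereal Fmin \<le> F z" and F_attained: "\<exists>z. F z = ereal Fmin"
    and \<gamma>_pos: "0 < \<gamma>" and \<gamma>_less: "\<gamma> < 1 / L"
    and PG: "pg_sequence f g \<gamma> x"
  shows "\<exists>xbar \<in> argmin F. converges_linearly F x xbar"
proof -
  have "edom g = UNIV"
    by (simp add: edom_def g_eq group_lasso_def)
  \<comment> \<open>Having gradients on \<open>C\<close> places \<open>C\<close> inside the domain
    of \<open>f\<close>, while \<open>g\<close> is finite everywhere, so \<open>C_dom\<close> gives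
    the converse. The domain is thus closed, open and nonempty, hence the whole connected
    space.\<close>
  with C_dom grad_Lipschitz(1) have C_eq: "C = edom f"
    using interior_subset by (fastforce simp: ediff_on_def has_egrad_def)
  then have "edom f = UNIV"
    using C_closed f_open f_proper clopen[of "edom f"] by (auto simp: proper_def)
  define \<phi> where "\<phi> z = real_of_ereal (h (A *v z))" for z
  have h_eq: "h (A *v z) = ereal (\<phi> z)" for z
  proof -
    have "f z \<noteq> \<infinity>"
      using \<open>edom f = UNIV\<close> by (auto simp: edom_def)
    then have "h (A *v z) \<noteq> \<infinity>"
      by (auto simp: f_eq)
    moreover have "h (A *v z) \<noteq> - \<infinity>"
      using h_proper by (simp add: proper_def)
    ultimately show ?thesis
      by (cases "h (A *v z)") (auto simp: \<phi>_def)
  qed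
  define f' where "f' = (\<lambda>z. \<phi> z + q \<bullet> z)"
  define G where "G = egrad f"
  have f_real: "f z = ereal (f' z)" for z
    by (simp add: f_eq f'_def h_eq)
  have deriv: "GDERIV f' z :> G z" for z
  proof -
    obtain d where d: "has_egrad f z d"
      using grad_Lipschitz(1) C_eq \<open>edom f = UNIV\<close> by (auto simp: ediff_on_def)
    then have "GDERIV f' z :> d"
      by (simp add: has_egrad_def f_real)
    then show ?thesis
      by (simp add: G_def egrad_eq[OF d])
  qed
  have lip: "L-lipschitz_on UNIV G"
    using grad_Lipschitz(2) C_eq \<open>edom f = UNIV\<close> by (simp add: G_def)
  let ?g = "group_norm \<J> \<omega>"
  define \<Phi> where "\<Phi> = (\<lambda>z. f' z + ?g z)"
  have g_real: "g z = ereal (?g z)" for z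
    by (simp add: g_eq group_lasso_def group_norm_def)
  have F_real: "F z = ereal (\<Phi> z)" for z
    by (simp add: F_eq f_real g_real \<Phi>_def)
  have lower: "Fmin \<le> \<Phi> z" for z
    using F_lower[of z] by (simp add: F_real)
  obtain xs where xs: "\<Phi> xs = Fmin"
    using F_attained by (auto simp: F_real)

  have A: "linear ((*v) A)"
    by simp
  \<comment> \<open>The image of a ball under \<open>A\<close> is compact, convex and inside the
    domain of \<open>h\<close>; the modulus may depend on the radius.\<close>
  have strong: "\<exists>\<mu>>0. \<forall>y\<in>cball 0 R. \<forall>z\<in>cball 0 R.
      f' y + G y \<bullet> (z - y) + \<mu> / 2 * (norm (A *v z - A *v y))\<^sup>2 \<le> f' z" for R
  proof -
    have "strongly_convex_on ((*v) A ` cball 0 R) h"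
    proof (rule h_strong)
      show "compact ((*v) A ` cball 0 R)"
        by (intro compact_continuous_image linear_continuous_on) auto
      show "convex ((*v) A ` cball 0 R)"
        by (intro convex_linear_image A convex_cball)
      show "(*v) A ` cball 0 R \<subseteq> edom h"
        by (auto simp: edom_def h_eq)
    qed
    from strongly_convex_composition_gradient[OF A this h_eq deriv[unfolded f'_def]]
    obtain \<mu> where "0 < \<mu>" "\<And>y z. y \<in> cball 0 R \<Longrightarrow> z \<in> cball 0 R \<Longrightarrow>
      \<phi> y + q \<bullet> y + G y \<bullet> (z - y) + \<mu> / 2 * (norm (A *v z - A *v y))\<^sup>2 \<le> \<phi> z + q \<bullet> z"
      by blast
    then show ?thesis
      unfolding f'_def by blast
  qed
  have f_convex: "f' y + G y \<bullet> (z - y) \<le> f' z" for y z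
  proof -
    obtain \<mu> where \<mu>: "0 < \<mu>"
      "f' y + G y \<bullet> (z - y) + \<mu> / 2 * (norm (A *v z - A *v y))\<^sup>2 \<le> f' z"
      using strong[of "max (norm y) (norm z)"] by auto
    moreover have "0 \<le> \<mu> / 2 * (norm (A *v z - A *v y))\<^sup>2"
      using \<mu>(1) by simp
    ultimately show ?thesis
      by linarith
  qed
  have g_convex: "convex_on UNIV ?g"
    using \<omega>_nonneg by (rule convex_on_group_norm)

  have step: "\<Phi> (x (Suc k))
      \<le> \<Phi> z + 1 / (2 * \<gamma>) * ((norm (z - x k))\<^sup>2 - (norm (z - x (Suc k)))\<^sup>2)" for k z
    unfolding \<Phi>_def
  proof (rule proximal_gradient_inequality[OF deriv lip f_convex g_convex \<gamma>_pos])
    show "L * \<gamma> \<le> 1"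
      using \<gamma>_less L_pos by (simp add: field_simps)
    fix y
    have "x (Suc k) \<in> prox g \<gamma> (x k - \<gamma> *\<^sub>R G (x k))"
      using PG by (simp add: pg_sequence_def G_def)
    then show "?g (x (Suc k)) + 1 / (2 * \<gamma>) * (norm (x (Suc k) - (x k - \<gamma> *\<^sub>R G (x k))))\<^sup>2
        \<le> ?g y + 1 / (2 * \<gamma>) * (norm (y - (x k - \<gamma> *\<^sub>R G (x k))))\<^sup>2"
      by (simp add: prox_def argmin_def is_arg_min_linorder g_real)
  qed
  \<comment> \<open>The step inequality at the optimal \<open>xs\<close>: the objective cannot fall
    below \<open>Fmin\<close>, so the distance to \<open>xs\<close> cannot grow.\<close>
  have fejer: "norm (xs - x (Suc k)) \<le> norm (xs - x k)" for k
  proof -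
    have "0 \<le> 1 / (2 * \<gamma>) * ((norm (xs - x k))\<^sup>2 - (norm (xs - x (Suc k)))\<^sup>2)"
      using step[of k xs] lower[of "x (Suc k)"] xs by linarith
    then have "(norm (xs - x (Suc k)))\<^sup>2 \<le> (norm (xs - x k))\<^sup>2"
      using \<gamma>_pos by (simp add: zero_le_divide_iff)
    then show ?thesis
      by simp
  qed
  \<comment> \<open>This ball contains \<open>xs\<close> as well as all iterates, so strong
    convexity on it applies with base point \<open>xs\<close>.\<close>
  define R where "R = norm xs + norm (xs - x 0)"
  have x_bound: "norm (x k) \<le> R" for k
  proof -
    have "norm (xs - x k) \<le> norm (xs - x 0)"
      using lift_Suc_antimono_le[of "\<lambda>k. norm (xs - x k)" 0 k] fejer by simp
    then show ?thesis
      using norm_triangle_sub[of "x k" xs] by (simp add: R_def norm_minus_commute)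
  qed

  obtain \<mu> where \<mu>: "0 < \<mu>" and sc: "\<forall>y\<in>cball 0 R. \<forall>z\<in>cball 0 R.
      f' y + G y \<bullet> (z - y) + \<mu> / 2 * (norm (A *v z - A *v y))\<^sup>2 \<le> f' z"
    using strong[of R] by blast
  obtain c where c: "0 < c" and growth: "\<And>z. norm z \<le> R \<Longrightarrow>
      \<exists>w. \<Phi> w = Fmin \<and> c * (norm (z - w))\<^sup>2 \<le> \<Phi> z - Fmin"
  proof (rule quadratic_growth[OF \<J>_partition \<omega>_nonneg _ deriv[of xs] _ _ \<mu>,
        where R = R and q = q and A = "(*v) A"])
    show "bounded_linear ((*v) A)"
      by simp
    show "f' xs + ?g xs \<le> f' z + ?g z" for z
      using lower[of z] xs by (simp add: \<Phi>_def)
    show "f' z = f' xs + q \<bullet> (z - xs)" if "A *v z = A *v xs" for z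
      using that by (simp add: f'_def \<phi>_def inner_diff_right)
    show "f' xs + G xs \<bullet> (z - xs) + \<mu> / 2 * (norm (A *v z - A *v xs))\<^sup>2 \<le> f' z"
      if "norm z \<le> R" for z
      using sc that by (simp add: R_def)
  qed (use xs in \<open>auto simp: \<Phi>_def intro: that\<close>)

  have \<Phi>_convex: "convex_on UNIV \<Phi>"
    unfolding \<Phi>_def by (intro convex_on_add convex_on_gradient_inequality[of f' G] f_convex g_convex)
  have "continuous_on UNIV f'"
    using deriv unfolding gderiv_def
    by (auto simp: continuous_on_eq_continuous_at intro: has_derivative_continuous)
  then have \<Phi>_cont: "continuous_on UNIV \<Phi>"
    unfolding \<Phi>_def by (intro continuous_on_add continuous_on_group_norm)
  obtain l \<sigma> \<rho>0 \<rho> where l: "\<Phi> l = Fmin" "0 < \<sigma>" "\<sigma> < 1" "0 < \<rho>0" "0 < \<rho>" "\<rho> < 1"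
    "\<And>k. \<Phi> (x (Suc k)) - Fmin \<le> \<sigma> * (\<Phi> (x k) - Fmin)"
    "\<And>k. norm (x k - l) \<le> \<rho>0 * \<rho> ^ k"
    using linear_convergence_of_quadratic_growth
      [OF \<Phi>_convex \<Phi>_cont \<gamma>_pos c lower, of x, OF step growth[OF x_bound]]
    by blast
  have "l \<in> argmin F"
    using lower l(1) by (simp add: argmin_def is_arg_min_linorder F_real)
  \<comment> \<open>The estimates hold from the start; \<open>k0 = 1\<close> is chosen because the
    definition asks for a positive index.\<close>
  moreover have "converges_linearly F x l"
    unfolding converges_linearly_def
    using l by (intro exI[of _ 1] conjI exI[of _ \<sigma>] exI[of _ \<rho>0] exI[of _ \<rho>] allI impI)
      (simp_all add: F_real)
  ultimately show ?thesis
    by blast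
qed

end
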